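(* For every $\varepsilon>0$ there exists $n_0=n_0(\varepsilon)\in\mathbb{N}$ such that the following holds for all $n\geq n_0$. Let $\mathcal{U}_{2n}=\{x\in\{0,1\}^{2n}: |x|=n\}$. If a function $f\colon \mathcal{U}_{2n}\to\{0,1\}$ satisfies \[ \Pr_{x,y,z}\big[f(x)\oplus f(y)\oplus f(z)=f(x\oplus y\oplus z)\ \big|\ x,y,z,x\oplus y\oplus z\in\mathcal{U}_{2n}\big]\geq \frac12+\varepsilon, \] where $x,y,z$ are uniform in $\{0,1\}^{2n}$ conditioned on $x,y,z,x\oplus y\oplus z\in\mathcal{U}_{2n}$, then there exist $S\subseteq[2n]$ and $b\in\{0,1\}$ such that \[ \Pr_{x\in\mathcal{U}_{2n}}\Big[f(x)=b\oplus\bigoplus_{i\in S}x_i\Big]\geq \frac12+\frac{\sqrt{\varepsilon}}{200}, \] where $x$ is uniform on $\mathcal{U}_{2n}$.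
   Context: $|x|$ denotes the Hamming weight (number of ones) of $x\in\{0,1\}^{2n}$, and $\oplus$ denotes coordinatewise addition modulo 2 (for vectors) or addition modulo 2 (for bits). *)

theory Defs
  imports "HOL-Probability.Probability" "HOL-Library.Z2"
begin

text \<open>
  Bits are elements of the two-element field \<^typ>\<open>bit\<close>, whose addition is addition modulo 2.
  Vectors in $\{0,1\}^m$ are functions on the index set $[m] = \{1,\dots,m\}$, extensional
  in the sense of \<^const>\<open>PiE\<close> (so that there are exactly $2^m$ of them).
\<close>

definition cube :: "nat \<Rightarrow> (nat \<Rightarrow> bit) set" where
  "cube m = {1..m} \<rightarrow>\<^sub>E UNIV"

definition vec_xor :: "nat \<Rightarrow> (nat \<Rightarrow> bit) \<Rightarrow> (nat \<Rightarrow> bit) \<Rightarrow> (nat \<Rightarrow> bit)" where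
  "vec_xor m x y = (\<lambda>i\<in>{1..m}. x i + y i)"

definition hamming_weight :: "nat \<Rightarrow> (nat \<Rightarrow> bit) \<Rightarrow> nat" where
  "hamming_weight m x = card {i \<in> {1..m}. x i = 1}"

text \<open>The middle slice $\mathcal{U}_{2n}$; the argument is \<open>n\<close>, not the dimension.\<close>

definition middle_slice :: "nat \<Rightarrow> (nat \<Rightarrow> bit) set" where
  "middle_slice n = {x \<in> cube (2 * n). hamming_weight (2 * n) x = n}"

end

theory Submission
  imports Defs
begin

text \<open>
  Let \<open>F = (-1)^f\<close>, and write \<open>a S\<close> and \<open>w S\<close> for the averages over the slice of \<open>F \<chi>\<^sub>S\<close> and \<open>\<chi>\<^sub>S\<close>.
  The test passes with probability at least \<open>1/2 + \<epsilon>\<close> iff \<open>\<Sum>\<^sub>S (a S)^4 \<ge> 2 \<epsilon> \<Sum>\<^sub>S (w S)^4\<close>, and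
  the two sets \<open>{}\<close>, \<open>[2n]\<close> alone make the right-hand side at least \<open>4 \<epsilon>\<close>. Every other \<open>w S\<close> is at
  most \<open>\<eta> = 1/(2n-1)\<close>, so the characters are almost orthogonal on the slice, up to the identification
  of \<open>S\<close> with its complement. Hence \<open>\<Sum>(a S)\<^sup>2 \<le> 4\<close> over the \<open>S\<close> with \<open>(a S)\<^sup>2 \<ge> 2 \<eta>\<close>, whatever the
  density of the slice. The remaining \<open>S\<close> contribute at most \<open>2 \<eta> \<Sum>\<^sub>S (a S)\<^sup>2 = O(1/sqrt n)\<close> to
  \<open>\<Sum>\<^sub>S (a S)^4\<close>, by Parseval. So \<open>4 \<epsilon> \<le> 4 max (a S)\<^sup>2 + O(1/sqrt n)\<close>.
\<close>

section \<open>Signs and Walsh characters\<close>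

definition bit_sign :: "bit \<Rightarrow> real" where
  "bit_sign b = (if b = 1 then -1 else 1)"

lemma bit_sign_0 [simp]: "bit_sign 0 = 1"
  and bit_sign_1 [simp]: "bit_sign 1 = -1"
  by (simp_all add: bit_sign_def)

lemma bit_sign_add: "bit_sign (a + b) = bit_sign a * bit_sign b"
  by (cases a; cases b) (simp_all add: bit_sign_def)

lemma bit_sign_square [simp]: "bit_sign b * bit_sign b = 1"
  by (cases b) simp_all

lemma abs_bit_sign [simp]: "\<bar>bit_sign b\<bar> = 1"
  by (cases b) simp_all

lemma of_bool_bit_eq: "of_bool (a = b) = (1 + bit_sign a * bit_sign b) / 2"
  by (cases a; cases b) simp_all

definition chi :: "nat set \<Rightarrow> (nat \<Rightarrow> bit) \<Rightarrow> real" where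
  "chi S x = (\<Prod>i\<in>S. bit_sign (x i))"

lemma bit_sign_sum: "finite S \<Longrightarrow> bit_sign (\<Sum>i\<in>S. x i) = chi S x"
  unfolding chi_def
  by (induction S rule: finite_induct) (simp_all add: bit_sign_add del: add_bit_eq_xor)

lemma chi_empty [simp]: "chi {} x = 1"
  by (simp add: chi_def)

lemma chi_square [simp]: "chi S x * chi S x = 1"
  by (simp add: chi_def flip: prod.distrib)

lemma chi_vec_xor:
  assumes "S \<subseteq> {1..m}"
  shows "chi S (vec_xor m x y) = chi S x * chi S y"
proof -
  have "(\<Prod>i\<in>S. bit_sign (vec_xor m x y i)) = (\<Prod>i\<in>S. bit_sign (x i) * bit_sign (y i))"
    using assms by (intro prod.cong) (auto simp: vec_xor_def bit_sign_add simp del: add_bit_eq_xor)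
  then show ?thesis
    by (simp add: chi_def prod.distrib)
qed

text \<open>In the product of the two characters the factors over \<open>S \<inter> T\<close> occur
  twice and square to 1.\<close>

lemma chi_sym_diff:
  assumes "finite S" "finite T"
  shows "chi (sym_diff S T) x = chi S x * chi T x"
proof -
  have S: "chi S x = chi (S - T) x * chi (S \<inter> T) x"
    unfolding chi_def using assms by (subst prod.union_disjoint [symmetric]) (auto intro: prod.cong)
  have T: "chi T x = chi (T - S) x * chi (S \<inter> T) x"
    unfolding chi_def using assms by (subst prod.union_disjoint [symmetric]) (auto intro: prod.cong)
  have "chi (sym_diff S T) x = chi (S - T) x * chi (T - S) x"
    unfolding chi_def using assms by (subst prod.union_disjoint) auto
  moreover have "chi S x * chi T x = chi (S - T) x * chi (T - S) x * (chi (S \<inter> T) x * chi (S \<inter> T) x)"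
    unfolding S T by (simp only: mult_ac)
  ultimately show ?thesis by simp
qed

text \<open>The sum over subsets is the expansion of the product of
  \<open>bit_sign (w i) + 1\<close>. A coordinate with \<open>w i = 1\<close> contributes the factor
  0, every other one the factor 2.\<close>

lemma sum_chi:
  "(\<Sum>S\<in>Pow {1..m}. chi S w) = (if \<forall>i\<in>{1..m}. w i = 0 then 2 ^ m else 0)"
proof -
  have "(\<Sum>S\<in>Pow {1..m}. chi S w) = (\<Prod>i\<in>{1..m}. bit_sign (w i) + 1)"
    by (subst prod_add) (simp_all add: chi_def)
  also have "\<dots> = (if \<forall>i\<in>{1..m}. w i = 0 then 2 ^ m else 0)"
  proof (cases "\<forall>i\<in>{1..m}. w i = 0")
    case True
    then have "(\<Prod>i\<in>{1..m}. bit_sign (w i) + 1) = (\<Prod>i\<in>{1..m}. 2)"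
      by (intro prod.cong) auto
    with True show ?thesis by simp
  next
    case False
    then obtain i where "i \<in> {1..m}" "w i = 1" by auto
    with False show ?thesis by (auto intro!: bexI[of _ i])
  qed
  finally show ?thesis .
qed

section \<open>The cube and the size of the middle slice\<close>

lemma cube_eqI: "x \<in> cube m \<Longrightarrow> y \<in> cube m \<Longrightarrow> (\<And>i. i \<in> {1..m} \<Longrightarrow> x i = y i) \<Longrightarrow> x = y"
  unfolding cube_def by (rule PiE_ext)

lemma vec_xor_in_cube: "vec_xor m x y \<in> cube m"
  by (simp add: vec_xor_def cube_def)

lemma finite_cube [simp]: "finite (cube m)"
proof -
  have "(UNIV :: bit set) = {0, 1}"
    using bit_not_zero_iff by auto
  then have "finite (UNIV :: bit set)"
    by (metis finite.emptyI finite.insertI)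
  then show ?thesis
    unfolding cube_def by (intro finite_PiE) simp_all
qed

text \<open>This orthogonality sums over characters for fixed points, so it stays exact when the
  points are restricted to the slice. It is \<open>sum_chi\<close> at \<open>vec_xor m x y\<close>,
  which vanishes exactly when \<open>x = y\<close>.\<close>

lemma chi_orthogonal:
  assumes "x \<in> cube m" "y \<in> cube m"
  shows "(\<Sum>S\<in>Pow {1..m}. chi S x * chi S y) = (if x = y then 2 ^ m else 0)"
proof -
  have "(\<Sum>S\<in>Pow {1..m}. chi S x * chi S y) = (\<Sum>S\<in>Pow {1..m}. chi S (vec_xor m x y))"
    by (intro sum.cong) (auto simp: chi_vec_xor)
  also have "\<dots> = (if \<forall>i\<in>{1..m}. vec_xor m x y i = 0 then 2 ^ m else 0)"
    by (rule sum_chi)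
  also have "(\<forall>i\<in>{1..m}. vec_xor m x y i = 0) \<longleftrightarrow> x = y"
  proof -
    have eq: "a + b = 0 \<longleftrightarrow> a = b" for a b :: bit
      by (cases a; cases b) simp_all
    show ?thesis
      using cube_eqI[OF assms] by (auto simp: vec_xor_def eq simp del: add_bit_eq_xor)
  qed
  finally show ?thesis .
qed

lemma finite_middle_slice [simp]: "finite (middle_slice n)"
  by (simp add: middle_slice_def)

lemma middle_slice_subset_cube: "middle_slice n \<subseteq> cube (2 * n)"
  by (auto simp: middle_slice_def)

lemma card_middle_slice: "card (middle_slice n) = (2 * n) choose n"
proof -
  have "bij_betw (\<lambda>x. {i \<in> {1..2*n}. x i = 1}) (middle_slice n) {B. B \<subseteq> {1..2*n} \<and> card B = n}"
  proof (rule bij_betw_byWitness[where f' = "\<lambda>B. \<lambda>i\<in>{1..2*n}. if i \<in> B then 1 else 0"])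
    show "\<forall>x\<in>middle_slice n. (\<lambda>i\<in>{1..2*n}. if i \<in> {i \<in> {1..2*n}. x i = 1} then 1 else 0) = x"
      by (auto simp: middle_slice_def intro!: cube_eqI[where m = "2*n"]) (auto simp: cube_def)
    show "\<forall>B\<in>{B. B \<subseteq> {1..2*n} \<and> card B = n}. 
       {i \<in> {1..2*n}. (\<lambda>i\<in>{1..2*n}. if i \<in> B then 1 else 0) i = (1::bit)} = B"
      by (auto split: if_splits)
    show "(\<lambda>x. {i \<in> {1..2*n}. x i = 1}) ` middle_slice n \<subseteq> {B. B \<subseteq> {1..2*n} \<and> card B = n}"
      by (auto simp: middle_slice_def hamming_weight_def)
    show "(\<lambda>B. \<lambda>i\<in>{1..2*n}. if i \<in> B then 1 else (0::bit)) ` {B. B \<subseteq> {1..2*n} \<and> card B = n} \<subseteq> middle_slice n"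
    proof safe
      fix B :: "nat set" assume B: "B \<subseteq> {1..2 * card B}"
      then have "{i \<in> {1..2*card B}. (\<lambda>i\<in>{1..2*card B}. if i \<in> B then 1 else (0::bit)) i = 1} = B"
        by (auto split: if_splits)
      then show "(\<lambda>i\<in>{1..2*card B}. if i \<in> B then 1 else (0::bit)) \<in> middle_slice (card B)"
        by (simp add: middle_slice_def hamming_weight_def cube_def)
    qed
  qed
  then have "card (middle_slice n) = card {B. B \<subseteq> {1..2*n} \<and> card B = n}"
    by (rule bij_betw_same_card)
  then show ?thesis by (simp add: n_subsets)
qed

lemma card_middle_slice_pos [simp]: "card (middle_slice n) > 0"
  by (simp add: card_middle_slice)

lemma middle_slice_nonempty [simp]: "middle_slice n \<noteq> {}"
  using card_middle_slice_pos[of n] by fastforce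

text \<open>The bound \<open>4 ^ n / (2 * sqrt n)\<close> for the central binomial coefficient,
  squared to stay in the naturals. The induction uses that consecutive coefficients have ratio
  \<open>2 * (2 * n + 1) / (n + 1)\<close>, together with
  \<open>4 * n * (n + 1) \<le> (2 * n + 1)^2\<close>.\<close>

lemma sixteen_power_le: "n \<ge> 1 \<Longrightarrow> 16 ^ n \<le> 4 * n * ((2 * n) choose n)\<^sup>2"
proof (induction n rule: dec_induct)
  case base
  show ?case by (simp add: numeral_2_eq_2)
next
  case (step n)
  define c where "c = (2 * n) choose n"
  define d where "d = (2 * Suc n) choose Suc n"
  have "Suc n * d = 2 * (2 * n + 1) * c"
  proof -
    have 1: "Suc n * d = (2 * Suc n) * ((2 * n + 1) choose n)"
      unfolding d_def using Suc_times_binomial[of n "2 * n + 1"] by simp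
    have 2: "(2 * n + 1) choose n = (2 * n + 1) choose Suc n"
      using binomial_symmetric[of n "2 * n + 1"] by simp
    have "Suc n * ((2 * n + 1) choose n) = (2 * n + 1) * c"
      unfolding 2 c_def using Suc_times_binomial[of n "2 * n"] by simp
    with 1 show ?thesis by (simp add: algebra_simps)
  qed
  then have eq: "(Suc n)\<^sup>2 * d\<^sup>2 = 4 * (2 * n + 1)\<^sup>2 * c\<^sup>2"
    by (metis (no_types, lifting) power_mult_distrib power2_eq_square mult_2 numeral_Bit0 mult.assoc)
  have "Suc n * 16 ^ Suc n = 16 * Suc n * 16 ^ n" by (simp add: algebra_simps)
  also have "\<dots> \<le> 16 * Suc n * (4 * n * c\<^sup>2)"
    using step.IH unfolding c_def by (intro mult_left_mono) simp_all
  also have "\<dots> = 4 * (4 * (4 * n * Suc n)) * c\<^sup>2" by (simp add: algebra_simps)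
  also have "\<dots> \<le> 4 * (4 * (2 * n + 1)\<^sup>2) * c\<^sup>2"
    by (intro mult_right_mono mult_left_mono) (simp_all add: power2_eq_square)
  also have "\<dots> = 4 * ((Suc n)\<^sup>2 * d\<^sup>2)" unfolding eq by simp
  also have "\<dots> = Suc n * (4 * Suc n * d\<^sup>2)" by (simp add: power2_eq_square algebra_simps)
  finally show ?case unfolding d_def by (subst (asm) Suc_mult_le_cancel1)
qed

section \<open>Character averages over the slice\<close>

text \<open>Normalised by the size of the slice, not of the cube. For \<open>F = 1\<close> it is the
  Fourier transform of the uniform distribution on the slice, whose values are normalised Krawtchouk
  numbers.\<close>

definition slice_coeff :: "nat \<Rightarrow> ((nat \<Rightarrow> bit) \<Rightarrow> real) \<Rightarrow> nat set \<Rightarrow> real" where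
  "slice_coeff n F S = (\<Sum>x\<in>middle_slice n. F x * chi S x) / card (middle_slice n)"

lemma sum_bit_sign_middle_slice:
  assumes "x \<in> middle_slice n"
  shows "(\<Sum>i\<in>{1..2*n}. bit_sign (x i)) = 0"
proof -
  let ?A = "{i \<in> {1..2*n}. x i = 1}"
  have c: "card ?A = n" using assms by (simp add: middle_slice_def hamming_weight_def)
  have "(\<Sum>i\<in>{1..2*n}. bit_sign (x i)) = (\<Sum>i\<in>{1..2*n}. 1 - 2 * (if x i = 1 then 1 else 0))"
    by (intro sum.cong) (auto simp: bit_sign_def)
  also have "\<dots> = 2 * real n - 2 * real (card ?A)"
    by (simp add: sum_subtractf flip: sum_distrib_left) (simp add: sum.If_cases Int_def)
  finally show ?thesis using c by simp
qed

lemma chi_full: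
  assumes "x \<in> middle_slice n"
  shows "chi {1..2*n} x = (-1) ^ n"
proof -
  let ?A = "{i \<in> {1..2*n}. x i = 1}"
  have "chi {1..2*n} x = (\<Prod>i\<in>{1..2*n}. if x i = 1 then -1 else 1)"
    unfolding chi_def bit_sign_def by simp
  also have "\<dots> = (-1) ^ card ?A"
    by (subst prod.If_cases) (simp_all add: Int_def)
  finally show ?thesis using assms by (simp add: middle_slice_def hamming_weight_def)
qed

text \<open>By \<open>chi_full\<close> the character of \<open>[2n]\<close> is the constant
  \<open>(-1) ^ n\<close> on the slice, so complementary sets have the same character there up to
  this sign. The absolute values absorb the sign for odd \<open>n\<close>.\<close>

lemma slice_coeff_compl:
  assumes "S \<subseteq> {1..2*n}"
  shows "\<bar>slice_coeff n F ({1..2*n} - S)\<bar> = \<bar>slice_coeff n F S\<bar>"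
proof -
  have "chi ({1..2*n} - S) x = (-1) ^ n * chi S x" if "x \<in> middle_slice n" for x
  proof -
    have "sym_diff {1..2*n} S = {1..2*n} - S" using assms by auto
    then show ?thesis
      using chi_sym_diff[of "{1..2*n}" S x] chi_full[OF that] finite_subset[OF assms] by simp
  qed
  then have "(\<Sum>x\<in>middle_slice n. F x * chi ({1..2*n} - S) x) = (\<Sum>x\<in>middle_slice n. (-1) ^ n * (F x * chi S x))"
    by (intro sum.cong) simp_all
  then show ?thesis
    by (simp add: slice_coeff_def abs_mult flip: sum_distrib_left)
qed

lemma slice_coeff_1_empty [simp]: "slice_coeff n (\<lambda>_. 1) {} = 1"
  using card_middle_slice_pos[of n] by (simp add: slice_coeff_def del: card_middle_slice_pos)

text \<open>The slice is invariant under permutations of the coordinates, and some permutation of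
  \<open>[2n]\<close> carries \<open>S\<close> to \<open>T\<close>.\<close>

lemma slice_coeff_1_card:
  assumes "S \<subseteq> {1..2*n}" "T \<subseteq> {1..2*n}" "card S = card T"
  shows "slice_coeff n (\<lambda>_. 1) S = slice_coeff n (\<lambda>_. 1) T"
proof -
  let ?N = "{1..2*n}"
  have fin: "finite S" "finite T" using assms finite_subset by blast+
  obtain p1 where p1: "bij_betw p1 S T"
    using finite_same_card_bij[OF fin assms(3)] by blast
  have "card (?N - S) = card (?N - T)"
    using assms fin by (simp add: card_Diff_subset)
  then obtain p2 where p2: "bij_betw p2 (?N - S) (?N - T)"
    using finite_same_card_bij[of "?N - S" "?N - T"] by blast
  \<comment> \<open>Bijections between the sets and between their complements are glued to a
    permutation of \<open>[2n]\<close>.\<close>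
  define p where "p = (\<lambda>i. if i \<in> S then p1 i else p2 i)"
  have "bij_betw p (S \<union> (?N - S)) (T \<union> (?N - T))"
    unfolding p_def by (rule bij_betw_disjoint_Un[OF p1 p2]) auto
  moreover have "S \<union> (?N - S) = ?N" "T \<union> (?N - T) = ?N" using assms by auto
  ultimately have p: "bij_betw p ?N ?N" by simp
  have pST: "bij_betw p S T"
    using p1 by (simp add: p_def cong: bij_betw_cong)
  define q where "q = inv_into ?N p"
  have q: "bij_betw q ?N ?N" unfolding q_def by (rule bij_betw_inv_into[OF p])
  have pq: "p (q i) = i" "q (p i) = i" "p i \<in> ?N" "q i \<in> ?N" if "i \<in> ?N" for i
    using that bij_betw_inv_into_right[OF p that] bij_betw_inv_into_left[OF p that]
      bij_betw_apply[OF p that] bij_betw_apply[OF q that] by (simp_all only: q_def)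
  have mem: "(\<lambda>i\<in>?N. x (r i)) \<in> middle_slice n"
    if x: "x \<in> middle_slice n" and r: "bij_betw r ?N ?N" for x :: "nat \<Rightarrow> bit" and r
  proof -
    have "bij_betw r {i \<in> ?N. x (r i) = 1} {i \<in> ?N. x i = 1}"
    proof (rule bij_betw_subset[OF r])
      show "r ` {i \<in> ?N. x (r i) = 1} = {i \<in> ?N. x i = 1}"
      proof (intro equalityI subsetI)
        fix j assume j: "j \<in> {i \<in> ?N. x i = 1}"
        then obtain i where "i \<in> ?N" "j = r i"
          using bij_betw_imp_surj_on[OF r] by (metis (lifting) imageE mem_Collect_eq)
        with j show "j \<in> r ` {i \<in> ?N. x (r i) = 1}" by simp
      next
        fix j assume "j \<in> r ` {i \<in> ?N. x (r i) = 1}"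
        then obtain i where "i \<in> ?N" "x (r i) = 1" "j = r i" by force
        then show "j \<in> {i \<in> ?N. x i = 1}" using bij_betw_apply[OF r] by simp
      qed
    qed blast
    then have "card {i \<in> ?N. x (r i) = 1} = card {i \<in> ?N. x i = 1}"
      by (rule bij_betw_same_card)
    moreover have "{i \<in> ?N. (\<lambda>i\<in>?N. x (r i)) i = 1} = {i \<in> ?N. x (r i) = 1}" by auto
    ultimately show ?thesis
      using x by (simp add: middle_slice_def hamming_weight_def cube_def)
  qed
  have "(\<Sum>x\<in>middle_slice n. chi S x) = (\<Sum>x\<in>middle_slice n. chi T x)"
  proof (rule sum.reindex_bij_witness[where i = "\<lambda>x. \<lambda>i\<in>?N. x (p i)" and j = "\<lambda>x. \<lambda>i\<in>?N. x (q i)"])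
    fix x assume x: "x \<in> middle_slice n"
    then have xc: "x \<in> cube (2 * n)" using middle_slice_subset_cube by blast
    show "(\<lambda>i\<in>?N. (\<lambda>i\<in>?N. x (q i)) (p i)) = x"
      by (rule cube_eqI[OF _ xc]) (use pq in \<open>auto simp: cube_def\<close>)
    show "(\<lambda>i\<in>?N. (\<lambda>i\<in>?N. x (p i)) (q i)) = x"
      by (rule cube_eqI[OF _ xc]) (use pq in \<open>auto simp: cube_def\<close>)
    show "(\<lambda>i\<in>?N. x (q i)) \<in> middle_slice n" by (rule mem[OF x q])
    show "(\<lambda>i\<in>?N. x (p i)) \<in> middle_slice n" by (rule mem[OF x p])
    have "chi T (\<lambda>i\<in>?N. x (q i)) = (\<Prod>i\<in>S. bit_sign ((\<lambda>i\<in>?N. x (q i)) (p i)))"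
      unfolding chi_def by (rule prod.reindex_bij_betw[OF pST, symmetric])
    also have "\<dots> = chi S x"
      unfolding chi_def using assms(1) pq by (intro prod.cong) auto
    finally show "chi T (\<lambda>i\<in>?N. x (q i)) = chi S x" .
  qed
  then show ?thesis by (simp add: slice_coeff_def)
qed

text \<open>On the slice \<open>\<Sum>\<^sub>i (-1)^(x i) = 0\<close>; multiplying by a character of level \<open>s\<close> and averaging
  links the levels \<open>s - 1\<close> and \<open>s + 1\<close>.\<close>

lemma slice_coeff_1_recurrence:
  assumes "s < 2 * n"
  shows "real s * slice_coeff n (\<lambda>_. 1) {1..s - 1} + (2 * real n - real s) * slice_coeff n (\<lambda>_. 1) {1..Suc s} = 0"
proof -
  let ?N = "{1..2*n}" and ?S = "{1..s}"
  \<comment> \<open>Multiplying by \<open>bit_sign (x i)\<close> removes \<open>i\<close> from the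
    index set or inserts it, and only the size of the resulting set matters. For
    \<open>s = 0\<close> the removal case is void and the truncated \<open>s - 1\<close> gets
    coefficient 0.\<close>
  have coeff: "(\<Sum>x\<in>middle_slice n. chi ?S x * bit_sign (x i)) / card (middle_slice n) =
      (if i \<in> ?S then slice_coeff n (\<lambda>_. 1) {1..s - 1} else slice_coeff n (\<lambda>_. 1) {1..Suc s})"
    if i: "i \<in> ?N" for i
  proof (cases "i \<in> ?S")
    case True
    have "chi ?S x * bit_sign (x i) = chi (?S - {i}) x" for x
      using True prod.remove[of ?S i "\<lambda>i. bit_sign (x i)"] by (simp add: chi_def mult.assoc[symmetric] mult_ac)
    moreover have "slice_coeff n (\<lambda>_. 1) (?S - {i}) = slice_coeff n (\<lambda>_. 1) {1..s - 1}"
      using assms True by (intro slice_coeff_1_card) auto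
    ultimately show ?thesis using True by (simp add: slice_coeff_def)
  next
    case False
    have "chi ?S x * bit_sign (x i) = chi (insert i ?S) x" for x
      using False by (simp add: chi_def)
    moreover have "slice_coeff n (\<lambda>_. 1) (insert i ?S) = slice_coeff n (\<lambda>_. 1) {1..Suc s}"
      using assms False i by (intro slice_coeff_1_card) auto
    ultimately show ?thesis
      unfolding if_not_P[OF False] by (simp add: slice_coeff_def)
  qed
  have "0 = (\<Sum>x\<in>middle_slice n. chi ?S x * (\<Sum>i\<in>?N. bit_sign (x i))) / card (middle_slice n)"
    using sum_bit_sign_middle_slice by simp
  also have "\<dots> = (\<Sum>i\<in>?N. (\<Sum>x\<in>middle_slice n. chi ?S x * bit_sign (x i)) / card (middle_slice n))"
    by (subst sum_divide_distrib[symmetric], subst sum.swap) (simp only: sum_distrib_left)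
  also have "\<dots> = (\<Sum>i\<in>?N. if i \<in> ?S then slice_coeff n (\<lambda>_. 1) {1..s - 1} else slice_coeff n (\<lambda>_. 1) {1..Suc s})"
    by (rule sum.cong[OF refl coeff])
  also have "\<dots> = real (card (?N \<inter> ?S)) * slice_coeff n (\<lambda>_. 1) {1..s - 1} +
      real (card (?N - ?S)) * slice_coeff n (\<lambda>_. 1) {1..Suc s}"
    by (simp only: sum.If_cases finite_atLeastAtMost Collect_mem_eq sum_constant Diff_eq)
  also have "?N \<inter> ?S = ?S" using assms by auto
  also have "card (?N - ?S) = 2 * n - s"
    using assms by (subst card_Diff_subset) auto
  finally show ?thesis using assms by (simp add: of_nat_diff)
qed

text \<open>The recurrence starts from the value 1 at level 0 and gives 0 at level 1 and
  \<open>- 1 / (2n - 1)\<close> at level 2. Going from level \<open>t\<close> to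
  \<open>t + 2\<close> multiplies the absolute value by \<open>(t + 1) / (2n - t - 1)\<close>, which
  is at most 1 below the middle level.\<close>

lemma abs_slice_coeff_1_initial_le:
  assumes "1 \<le> s" "s \<le> n"
  shows "\<bar>slice_coeff n (\<lambda>_. 1) {1..s}\<bar> \<le> 1 / (2 * real n - 1)"
  using assms
proof (induction s rule: less_induct)
  case (less s)
  let ?w = "slice_coeff n (\<lambda>_. 1)"
  consider "s = 1" | "s = 2" | t where "s = Suc (Suc t)" "t \<ge> 1"
    using less.prems by (metis One_nat_def Suc_1 less_one linorder_not_less not0_implies_Suc)
  then show ?case
  proof cases
    case 1
    then have "?w {1..s} = 0"
      using slice_coeff_1_recurrence[of 0 n] less.prems by simp
    then show ?thesis using less.prems by simp
  next
    case 2
    then have "1 + (2 * real n - 1) * ?w {1..s} = 0"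
      using slice_coeff_1_recurrence[of 1 n] less.prems by (simp add: numeral_2_eq_2)
    then have "?w {1..s} = - (1 / (2 * real n - 1))"
      using less.prems by (simp add: field_simps)
    then show ?thesis using less.prems by simp
  next
    case 3
    have "real (Suc t) * ?w {1..t} + (2 * real n - real (Suc t)) * ?w {1..s} = 0"
      using slice_coeff_1_recurrence[of "Suc t" n] 3 less.prems by simp
    then have "(2 * real n - real (Suc t)) * ?w {1..s} = - (real (Suc t) * ?w {1..t})"
      by linarith
    then have "\<bar>(2 * real n - real (Suc t)) * ?w {1..s}\<bar> = \<bar>real (Suc t) * ?w {1..t}\<bar>"
      by simp
    then have eq: "(2 * real n - real (Suc t)) * \<bar>?w {1..s}\<bar> = real (Suc t) * \<bar>?w {1..t}\<bar>"
      using 3 less.prems by (simp add: abs_mult)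
    also have "\<dots> \<le> (2 * real n - real (Suc t)) * \<bar>?w {1..t}\<bar>"
      using 3 less.prems by (intro mult_right_mono) auto
    finally have "\<bar>?w {1..s}\<bar> \<le> \<bar>?w {1..t}\<bar>"
      using 3 less.prems by (subst (asm) mult_le_cancel_left_pos) auto
    also have "\<dots> \<le> 1 / (2 * real n - 1)"
      using 3 less.prems by (intro less.IH) auto
    finally show ?thesis .
  qed
qed

text \<open>A set with more than \<open>n\<close> elements is replaced by its complement, which has
  the same absolute average.\<close>

lemma abs_slice_coeff_1_le:
  assumes "S \<subseteq> {1..2*n}" "S \<noteq> {}" "S \<noteq> {1..2*n}"
  shows "\<bar>slice_coeff n (\<lambda>_. 1) S\<bar> \<le> 1 / (2 * real n - 1)"
proof -
  have small: "\<bar>slice_coeff n (\<lambda>_. 1) T\<bar> \<le> 1 / (2 * real n - 1)"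
    if T: "T \<subseteq> {1..2*n}" "T \<noteq> {}" "card T \<le> n" for T
  proof -
    have "card T \<ge> 1" using T finite_subset[of T "{1..2*n}"] by (simp add: Suc_le_eq card_gt_0_iff)
    moreover have "slice_coeff n (\<lambda>_. 1) T = slice_coeff n (\<lambda>_. 1) {1..card T}"
      using T by (intro slice_coeff_1_card) auto
    ultimately show ?thesis using abs_slice_coeff_1_initial_le T(3) by simp
  qed
  show ?thesis
  proof (cases "card S \<le> n")
    case True
    then show ?thesis using small assms by blast
  next
    case False
    have "card ({1..2*n} - S) \<le> n"
      using False assms(1) by (subst card_Diff_subset) (auto intro: finite_subset)
    moreover have "{1..2*n} - S \<noteq> {}" using assms by auto
    ultimately show ?thesis
      using small[of "{1..2*n} - S"] slice_coeff_compl[OF assms(1), of "\<lambda>_. 1"] by (metis Diff_subset)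
  qed
qed

section \<open>Second and fourth moments of the coefficients, and the large spectrum\<close>

text \<open>Parseval for \<open>F\<close> extended by 0 outside the slice: summing over
  \<open>S\<close> kills all pairs with \<open>x \<noteq> y\<close>. For \<open>F\<close> with
  values of absolute value 1 the total is the inverse density of the slice.\<close>

lemma sum_slice_coeff_square:
  "(\<Sum>S\<in>Pow {1..2*n}. (slice_coeff n F S)\<^sup>2) =
    2 ^ (2*n) / (real (card (middle_slice n)))\<^sup>2 * (\<Sum>x\<in>middle_slice n. (F x)\<^sup>2)"
proof -
  let ?U = "middle_slice n"
  have "(\<Sum>S\<in>Pow {1..2*n}. (\<Sum>x\<in>?U. F x * chi S x)\<^sup>2) =
      (\<Sum>S\<in>Pow {1..2*n}. \<Sum>x\<in>?U. \<Sum>y\<in>?U. F x * F y * (chi S x * chi S y))"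
    by (simp add: power2_eq_square sum_product mult_ac)
  also have "\<dots> = (\<Sum>x\<in>?U. \<Sum>y\<in>?U. F x * F y * (\<Sum>S\<in>Pow {1..2*n}. chi S x * chi S y))"
    by (subst sum.swap, rule sum.cong[OF refl], subst sum.swap) (simp only: sum_distrib_left)
  also have "\<dots> = (\<Sum>x\<in>?U. \<Sum>y\<in>?U. F x * F y * (if x = y then 2 ^ (2*n) else 0))"
    using middle_slice_subset_cube[of n] by (intro sum.cong refl arg_cong2[where f = "(*)"] chi_orthogonal) auto
  also have "\<dots> = (\<Sum>x\<in>?U. 2 ^ (2*n) * (F x)\<^sup>2)"
    by (intro sum.cong refl) (simp add: if_distrib[of "(*) _"] power2_eq_square cong: if_cong)
  finally show ?thesis
    by (simp add: slice_coeff_def power_divide sum_divide_distrib [symmetric] sum_distrib_left)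
qed

abbreviation xor3 :: "nat \<Rightarrow> (nat \<Rightarrow> bit) \<times> (nat \<Rightarrow> bit) \<times> (nat \<Rightarrow> bit) \<Rightarrow> (nat \<Rightarrow> bit)" where
  "xor3 m \<equiv> \<lambda>(x, y, z). vec_xor m (vec_xor m x y) z"

definition slice_triples :: "nat \<Rightarrow> ((nat \<Rightarrow> bit) \<times> (nat \<Rightarrow> bit) \<times> (nat \<Rightarrow> bit)) set" where
  "slice_triples n = {p \<in> middle_slice n \<times> middle_slice n \<times> middle_slice n. xor3 (2 * n) p \<in> middle_slice n}"

lemma finite_slice_triples [simp]: "finite (slice_triples n)"
  by (simp add: slice_triples_def)

text \<open>The fourth power expands over quadruples of slice points, and summing over
  \<open>S\<close> forces the fourth point to be the xor of the other three. What remains are the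
  triples on which the test is conditioned: \<open>F = 1\<close> counts them, and
  \<open>F = (-1)^f\<close> gives passes minus failures.\<close>

lemma sum_slice_coeff_power4:
  "(\<Sum>S\<in>Pow {1..2*n}. slice_coeff n F S ^ 4) =
    2 ^ (2*n) / real (card (middle_slice n)) ^ 4 *
      (\<Sum>p\<in>slice_triples n. (case p of (x, y, z) \<Rightarrow> F x * F y * F z) * F (xor3 (2 * n) p))"
proof -
  let ?U = "middle_slice n" and ?P = "Pow {1..2*n}"
  let ?T = "?U \<times> ?U \<times> ?U"
  define F3 where "F3 = (\<lambda>(x, y, z). F x * F y * F z)"
  have cube3: "(\<Sum>x\<in>?U. F x * chi S x) ^ 3 = (\<Sum>p\<in>?T. F3 p * chi S (xor3 (2*n) p))" if "S \<in> ?P" for S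
  proof -
    have "(\<Sum>x\<in>?U. F x * chi S x) ^ 3 =
        (\<Sum>x\<in>?U. F x * chi S x) * ((\<Sum>x\<in>?U. F x * chi S x) * (\<Sum>x\<in>?U. F x * chi S x))"
      by (simp add: power3_eq_cube mult.assoc)
    also have "\<dots> = (\<Sum>p\<in>?T. (case p of (x, y, z) \<Rightarrow> (F x * chi S x) * ((F y * chi S y) * (F z * chi S z))))"
      by (simp only: sum_product) (simp only: sum_distrib_left, simp only: sum.cartesian_product)
    also have "\<dots> = (\<Sum>p\<in>?T. F3 p * chi S (xor3 (2*n) p))"
      using that by (intro sum.cong) (auto simp: F3_def chi_vec_xor)
    finally show ?thesis .
  qed
  have "(\<Sum>S\<in>?P. (\<Sum>x\<in>?U. F x * chi S x) ^ 4) =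
      (\<Sum>S\<in>?P. (\<Sum>x\<in>?U. F x * chi S x) ^ 3 * (\<Sum>x\<in>?U. F x * chi S x))"
    by (simp add: eval_nat_numeral mult_ac)
  also have "\<dots> = (\<Sum>S\<in>?P. \<Sum>p\<in>?T. \<Sum>t\<in>?U. F3 p * F t * (chi S (xor3 (2*n) p) * chi S t))"
    by (intro sum.cong refl) (simp only: cube3 sum_product, simp only: mult_ac)
  also have "\<dots> = (\<Sum>p\<in>?T. \<Sum>t\<in>?U. F3 p * F t * (\<Sum>S\<in>?P. chi S (xor3 (2*n) p) * chi S t))"
    by (subst sum.swap, rule sum.cong[OF refl], subst sum.swap) (simp only: sum_distrib_left)
  also have "\<dots> = (\<Sum>p\<in>?T. \<Sum>t\<in>?U. F3 p * F t * (if xor3 (2*n) p = t then 2 ^ (2*n) else 0))"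
    using middle_slice_subset_cube[of n]
    by (intro sum.cong refl arg_cong2[where f = "(*)"] chi_orthogonal) (auto simp: vec_xor_in_cube)
  also have "\<dots> = (\<Sum>p\<in>?T. if xor3 (2*n) p \<in> ?U then 2 ^ (2*n) * (F3 p * F (xor3 (2*n) p)) else 0)"
    by (intro sum.cong refl) (simp add: if_distrib[of "(*) _"] mult_ac cong: if_cong)
  also have "\<dots> = (\<Sum>p\<in>slice_triples n. 2 ^ (2*n) * (F3 p * F (xor3 (2*n) p)))"
    unfolding slice_triples_def by (rule sum.inter_filter [symmetric]) simp
  finally show ?thesis
    by (simp add: slice_coeff_def power_divide sum_divide_distrib [symmetric] sum_distrib_left F3_def)
qed

text \<open>Tomas--Stein argument: on the large spectrum duality turns the near-orthogonality of the
  characters over the slice into a bound that does not depend on the density of the slice.\<close>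

lemma sum_large_coeff_le:
  assumes n: "n \<ge> 1" and F: "\<And>x. x \<in> middle_slice n \<Longrightarrow> \<bar>F x\<bar> \<le> 1"
    and R: "R \<subseteq> Pow {1..2*n}"
    and large: "\<And>S. S \<in> R \<Longrightarrow> 2 / (2 * real n - 1) \<le> (slice_coeff n F S)\<^sup>2"
  shows "(\<Sum>S\<in>R. (slice_coeff n F S)\<^sup>2) \<le> 4"
proof -
  let ?U = "middle_slice n" and ?N = "{1..2*n}"
  let ?a = "slice_coeff n F" and ?w = "slice_coeff n (\<lambda>_. 1)"
  define \<eta> where "\<eta> = 1 / (2 * real n - 1)"
  define c where "c = real (card ?U)"
  define A where "A = (\<Sum>S\<in>R. (?a S)\<^sup>2)"
  \<comment> \<open>The dual function: pairing \<open>F\<close> with it over the slice recovers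
    \<open>c * A\<close>.\<close>
  define G where "G x = (\<Sum>S\<in>R. ?a S * chi S x)" for x
  have \<eta>: "\<eta> > 0" using n by (simp add: \<eta>_def)
  have c: "c > 0" by (simp add: c_def)
  have finR: "finite R" using R finite_subset by auto
  have finS: "finite S" if "S \<in> R" for S using R that finite_subset[of S ?N] by auto
  have A0: "A \<ge> 0" by (simp add: A_def sum_nonneg)
  have coeff: "c * ?a S = (\<Sum>x\<in>?U. F x * chi S x)" for S
    using c by (simp add: slice_coeff_def c_def)
  have "c * A = (\<Sum>S\<in>R. ?a S * (c * ?a S))"
    by (simp add: A_def power2_eq_square sum_distrib_left mult_ac)
  also have "\<dots> = (\<Sum>x\<in>?U. F x * G x)"
    unfolding coeff G_def sum_distrib_left by (subst sum.swap) (simp add: mult_ac)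
  finally have cA: "c * A = (\<Sum>x\<in>?U. F x * G x)" .
  \<comment> \<open>Cauchy-Schwarz replaces \<open>F\<close> by its bound 1, leaving a quadratic
    form in the coefficients whose matrix consists of the averages
    \<open>?w (sym_diff S T)\<close>.\<close>
  have "(c * A)\<^sup>2 \<le> (\<Sum>x\<in>?U. (F x)\<^sup>2) * (\<Sum>x\<in>?U. (G x)\<^sup>2)"
    unfolding cA by (rule Cauchy_Schwarz_ineq_sum)
  also have "\<dots> \<le> c * (\<Sum>x\<in>?U. (G x)\<^sup>2)"
  proof (rule mult_right_mono)
    have "(\<Sum>x\<in>?U. (F x)\<^sup>2) \<le> (\<Sum>x\<in>?U. 1)"
      using F by (intro sum_mono) (simp add: abs_square_le_1)
    then show "(\<Sum>x\<in>?U. (F x)\<^sup>2) \<le> c" by (simp add: c_def)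
  qed (simp add: sum_nonneg)
  also have "(\<Sum>x\<in>?U. (G x)\<^sup>2) = c * (\<Sum>S\<in>R. \<Sum>T\<in>R. ?a S * ?a T * ?w (sym_diff S T))"
  proof -
    have "(\<Sum>x\<in>?U. (G x)\<^sup>2) = (\<Sum>x\<in>?U. \<Sum>S\<in>R. \<Sum>T\<in>R. ?a S * ?a T * chi (sym_diff S T) x)"
      unfolding G_def power2_eq_square sum_product
      by (intro sum.cong refl) (simp add: chi_sym_diff finS mult_ac)
    also have "\<dots> = (\<Sum>S\<in>R. \<Sum>T\<in>R. ?a S * ?a T * (\<Sum>x\<in>?U. chi (sym_diff S T) x))"
      by (subst sum.swap, rule sum.cong[OF refl], subst sum.swap) (simp only: sum_distrib_left)
    also have "\<dots> = (\<Sum>S\<in>R. \<Sum>T\<in>R. ?a S * ?a T * (c * ?w (sym_diff S T)))"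
      using c by (simp add: slice_coeff_def[of n "\<lambda>_. 1"] flip: c_def)
    finally show ?thesis
      by (simp add: sum_distrib_left mult_ac)
  qed
  finally have "A\<^sup>2 \<le> (\<Sum>S\<in>R. \<Sum>T\<in>R. ?a S * ?a T * ?w (sym_diff S T))" (is "_ \<le> ?D")
    using c by (simp add: power_mult_distrib power2_eq_square mult_ac)
  \<comment> \<open>The entry is 1 in absolute value for equal or complementary sets, and at most
    \<open>\<eta>\<close> otherwise.\<close>
  also have "?D \<le> (\<Sum>S\<in>R. \<Sum>T\<in>R. \<bar>?a S\<bar> * \<bar>?a T\<bar> * (of_bool (T = S) + of_bool (T = ?N - S) + \<eta>))"
  proof (intro sum_mono)
    fix S T assume ST: "S \<in> R" "T \<in> R"
    then have sub: "S \<subseteq> ?N" "T \<subseteq> ?N" using R by auto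
    have w: "\<bar>?w (sym_diff S T)\<bar> \<le> of_bool (T = S) + of_bool (T = ?N - S) + \<eta>"
    proof -
      consider "T = S" | "T = ?N - S" | "sym_diff S T \<noteq> {}" "sym_diff S T \<noteq> ?N"
        using sub by blast
      then show ?thesis
      proof cases
        case 1
        then show ?thesis using \<eta> by simp
      next
        case 2
        then have "sym_diff S T = ?N - {}" using sub by auto
        then have "\<bar>?w (sym_diff S T)\<bar> = 1"
          using slice_coeff_compl[of "{}" n "\<lambda>_. 1"] by simp
        with 2 \<eta> show ?thesis by simp
      next
        case 3
        then have "\<bar>?w (sym_diff S T)\<bar> \<le> \<eta>"
          using sub unfolding \<eta>_def by (intro abs_slice_coeff_1_le) auto
        moreover have "0 \<le> (of_bool (T = S) + of_bool (T = ?N - S) :: real)" by simp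
        ultimately show ?thesis by linarith
      qed
    qed
    have "?a S * ?a T * ?w (sym_diff S T) \<le> \<bar>?a S * ?a T * ?w (sym_diff S T)\<bar>" by simp
    also have "\<dots> = \<bar>?a S\<bar> * \<bar>?a T\<bar> * \<bar>?w (sym_diff S T)\<bar>" by (simp only: abs_mult)
    also have "\<dots> \<le> \<bar>?a S\<bar> * \<bar>?a T\<bar> * (of_bool (T = S) + of_bool (T = ?N - S) + \<eta>)"
      using w by (intro mult_left_mono) auto
    finally show "?a S * ?a T * ?w (sym_diff S T) \<le> \<dots>" .
  qed
  also have "\<dots> = (\<Sum>S\<in>R. \<Sum>T\<in>R. of_bool (T = S) * (\<bar>?a S\<bar> * \<bar>?a T\<bar>)) +
      (\<Sum>S\<in>R. \<Sum>T\<in>R. of_bool (T = ?N - S) * (\<bar>?a S\<bar> * \<bar>?a T\<bar>)) + \<eta> * (\<Sum>S\<in>R. \<bar>?a S\<bar>)\<^sup>2"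
    by (simp add: distrib_left sum.distrib power2_eq_square sum_product sum_distrib_left mult_ac)
  also have "(\<Sum>S\<in>R. \<Sum>T\<in>R. of_bool (T = S) * (\<bar>?a S\<bar> * \<bar>?a T\<bar>)) = A"
    using finR by (simp add: A_def of_bool_def if_distrib[of "\<lambda>x. x * _"] power2_eq_square cong: if_cong)
  \<comment> \<open>Each \<open>S\<close> has at most one complement in \<open>R\<close>, and its
    coefficient has the same absolute value.\<close>
  also have "(\<Sum>S\<in>R. \<Sum>T\<in>R. of_bool (T = ?N - S) * (\<bar>?a S\<bar> * \<bar>?a T\<bar>)) \<le> A"
    unfolding A_def
  proof (intro sum_mono)
    fix S assume "S \<in> R"
    then have "S \<subseteq> ?N" using R by auto
    have "(\<Sum>T\<in>R. of_bool (T = ?N - S) * (\<bar>?a S\<bar> * \<bar>?a T\<bar>)) =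
        (if ?N - S \<in> R then \<bar>?a S\<bar> * \<bar>?a (?N - S)\<bar> else 0)"
      using finR by (simp add: of_bool_def if_distrib[of "\<lambda>x. x * _"] cong: if_cong)
    also have "\<dots> \<le> (?a S)\<^sup>2"
      unfolding slice_coeff_compl[OF \<open>S \<subseteq> ?N\<close>] by (simp add: power2_eq_square flip: abs_mult)
    finally show "(\<Sum>T\<in>R. of_bool (T = ?N - S) * (\<bar>?a S\<bar> * \<bar>?a T\<bar>)) \<le> (?a S)\<^sup>2" .
  qed
  \<comment> \<open>This is where largeness enters: every \<open>\<bar>?a S\<bar>\<close> is at
    least \<open>sqrt (2 * \<eta>)\<close>, so the sum of the absolute values is at most
    \<open>A / sqrt (2 * \<eta>)\<close>. The threshold \<open>2 * \<eta>\<close> makes this term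
    half of the left-hand side, so that it can be absorbed.\<close>
  also have "\<eta> * (\<Sum>S\<in>R. \<bar>?a S\<bar>)\<^sup>2 \<le> A\<^sup>2 / 2"
  proof -
    have "sqrt (2 * \<eta>) * (\<Sum>S\<in>R. \<bar>?a S\<bar>) \<le> A"
      unfolding A_def sum_distrib_left
    proof (intro sum_mono)
      fix S assume "S \<in> R"
      then have "sqrt (2 * \<eta>) \<le> \<bar>?a S\<bar>"
        using large by (simp add: real_le_lsqrt real_sqrt_le_iff flip: real_sqrt_abs) (simp add: \<eta>_def)
      then have "sqrt (2 * \<eta>) * \<bar>?a S\<bar> \<le> \<bar>?a S\<bar> * \<bar>?a S\<bar>" by (intro mult_right_mono) auto
      then show "sqrt (2 * \<eta>) * \<bar>?a S\<bar> \<le> (?a S)\<^sup>2" by (simp add: power2_eq_square)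
    qed
    then have "(sqrt (2 * \<eta>) * (\<Sum>S\<in>R. \<bar>?a S\<bar>))\<^sup>2 \<le> A\<^sup>2"
      using \<eta> by (intro power_mono) (simp_all add: sum_nonneg)
    then show ?thesis using \<eta> by (simp add: power_mult_distrib)
  qed
  finally have "A\<^sup>2 \<le> A + A + A\<^sup>2 / 2" by simp
  then have "A * A \<le> 4 * A" by (simp add: power2_eq_square)
  then have "A \<le> 4" using A0 by (cases "A = 0") (auto simp: mult_le_cancel_right)
  then show ?thesis by (simp add: A_def)
qed

text \<open>One factor \<open>(slice_coeff n F S)^2\<close> is bounded by \<open>M\<close> on the
  large spectrum and by the threshold \<open>2 / (2n - 1)\<close> off it. The remaining factors sum
  to at most 4 and, by Parseval, to at most \<open>2 * sqrt n\<close>.\<close>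

lemma sum_slice_coeff_power4_le:
  assumes n: "n \<ge> 1" and F: "\<And>x. x \<in> middle_slice n \<Longrightarrow> \<bar>F x\<bar> \<le> 1"
    and M: "\<And>S. S \<subseteq> {1..2*n} \<Longrightarrow> (slice_coeff n F S)\<^sup>2 \<le> M"
  shows "(\<Sum>S\<in>Pow {1..2*n}. slice_coeff n F S ^ 4) \<le> 4 * M + 4 * sqrt n / (2 * real n - 1)"
proof -
  let ?a = "slice_coeff n F" and ?P = "Pow {1..2*n}" and ?U = "middle_slice n"
  define \<delta> where "\<delta> = 2 / (2 * real n - 1)"
  define c where "c = real (card ?U)"
  define R where "R = {S \<in> ?P. \<delta> \<le> (?a S)\<^sup>2}"
  have \<delta>: "\<delta> > 0" using n by (simp add: \<delta>_def)
  have c: "c > 0" by (simp add: c_def)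
  have M0: "M \<ge> 0" using M[of "{}"] by (meson empty_subsetI order_trans zero_le_power2)
  have pw: "?a S ^ 4 = (?a S)\<^sup>2 * (?a S)\<^sup>2" for S by (simp flip: power_add)
  \<comment> \<open>The \<open>\<delta>\<close> term is granted to every \<open>S\<close>, also to
    those in \<open>R\<close>, so that Parseval applies to the full sum.\<close>
  have "(\<Sum>S\<in>?P. ?a S ^ 4) \<le> (\<Sum>S\<in>?P. M * (if S \<in> R then (?a S)\<^sup>2 else 0) + \<delta> * (?a S)\<^sup>2)"
  proof (rule sum_mono)
    fix S assume S: "S \<in> ?P"
    show "?a S ^ 4 \<le> M * (if S \<in> R then (?a S)\<^sup>2 else 0) + \<delta> * (?a S)\<^sup>2"
    proof (cases "S \<in> R")
      case True
      have "?a S ^ 4 \<le> M * (?a S)\<^sup>2"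
        unfolding pw using M S by (intro mult_right_mono) auto
      with True \<delta> show ?thesis by (simp add: add_increasing2)
    next
      case False
      then have "?a S ^ 4 \<le> \<delta> * (?a S)\<^sup>2"
        unfolding pw using S by (intro mult_right_mono) (auto simp: R_def)
      with False show ?thesis by simp
    qed
  qed
  also have "\<dots> = M * (\<Sum>S\<in>R. (?a S)\<^sup>2) + \<delta> * (\<Sum>S\<in>?P. (?a S)\<^sup>2)"
  proof -
    have "?P \<inter> R = R" by (auto simp: R_def)
    then show ?thesis by (simp add: sum.distrib sum.If_cases flip: sum_distrib_left)
  qed
  also have "\<dots> \<le> M * 4 + \<delta> * (2 * sqrt n)"
  proof (intro add_mono mult_left_mono)
    show "(\<Sum>S\<in>R. (?a S)\<^sup>2) \<le> 4"
      using n F by (rule sum_large_coeff_le) (auto simp: R_def \<delta>_def)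
    have "(\<Sum>x\<in>?U. (F x)\<^sup>2) \<le> (\<Sum>x\<in>?U. 1)"
      using F by (intro sum_mono) (simp add: abs_square_le_1)
    then have "(\<Sum>S\<in>?P. (?a S)\<^sup>2) \<le> 2 ^ (2*n) / c\<^sup>2 * c"
      unfolding sum_slice_coeff_square c_def by (intro mult_left_mono) simp_all
    also have "\<dots> = 2 ^ (2*n) / c" by (simp add: power2_eq_square)
    also have "\<dots> \<le> 2 * sqrt n"
    proof -
      have "real (16 ^ n) \<le> real (4 * n * ((2 * n) choose n)\<^sup>2)"
        using sixteen_power_le[OF n] by (rule of_nat_mono)
      moreover have "((2::real) ^ (2*n))\<^sup>2 = 16 ^ n"
        by (simp add: power_mult flip: power_mult_distrib power2_eq_square) (simp add: power2_eq_square flip: power_mult_distrib)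
      ultimately have "(2 ^ (2*n))\<^sup>2 \<le> (2 * sqrt n * c)\<^sup>2"
        by (simp add: c_def card_middle_slice power_mult_distrib mult_ac)
      then have "2 ^ (2*n) \<le> 2 * sqrt n * c"
        by (rule power2_le_imp_le) (use c in simp)
      then show ?thesis using c by (simp add: field_simps)
    qed
    finally show "(\<Sum>S\<in>?P. (?a S)\<^sup>2) \<le> 2 * sqrt n" .
  qed (use M0 \<delta> in simp_all)
  finally show ?thesis by (simp add: \<delta>_def mult.commute)
qed

section \<open>Agreement probabilities in terms of coefficients\<close>

lemma card_agree_eq:
  assumes "finite A"
  shows "real (card {x \<in> A. f x = g x}) = (card A + (\<Sum>x\<in>A. bit_sign (f x) * bit_sign (g x))) / 2"
proof -
  have "real (card {x \<in> A. f x = g x}) = (\<Sum>x\<in>A. of_bool (f x = g x))"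
    using assms by (simp add: sum.If_cases of_bool_def Int_def)
  also have "\<dots> = (card A + (\<Sum>x\<in>A. bit_sign (f x) * bit_sign (g x))) / 2"
    unfolding of_bool_bit_eq by (simp add: sum.distrib add_divide_distrib sum_divide_distrib)
  finally show ?thesis .
qed

text \<open>Agreement of two bits has indicator \<open>(1 + product of signs) / 2\<close>. The bit
  \<open>b\<close> lets a coefficient of either sign yield an advantage over 1/2.\<close>

lemma prob_agree_chi:
  assumes "S \<subseteq> {1..2*n}"
  shows "\<P>(x in measure_pmf (pmf_of_set (middle_slice n)). f x = b + (\<Sum>i\<in>S. x i)) =
    (1 + bit_sign b * slice_coeff n (\<lambda>x. bit_sign (f x)) S) / 2"
proof -
  let ?U = "middle_slice n"
  have fin: "finite S" using assms finite_subset by blast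
  have "\<P>(x in measure_pmf (pmf_of_set ?U). f x = b + (\<Sum>i\<in>S. x i)) =
      real (card {x \<in> ?U. f x = b + (\<Sum>i\<in>S. x i)}) / card ?U"
    by (simp add: measure_pmf_of_set Int_def del: add_bit_eq_xor)
  also have "\<dots> = (card ?U + bit_sign b * (\<Sum>x\<in>?U. bit_sign (f x) * chi S x)) / 2 / card ?U"
    by (simp only: card_agree_eq finite_middle_slice bit_sign_add bit_sign_sum[OF fin] sum_distrib_left mult_ac)
  also have "\<dots> = (1 + bit_sign b * slice_coeff n (\<lambda>x. bit_sign (f x)) S) / 2"
    using card_middle_slice_pos[of n] by (simp add: slice_coeff_def field_simps del: card_middle_slice_pos)
  finally show ?thesis .
qed

lemma cond_prob_pmf_of_set:
  assumes "finite A" "A \<noteq> {}"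
  shows "cond_prob (measure_pmf (pmf_of_set A)) P Q = card {x \<in> A. P x \<and> Q x} / card {x \<in> A. Q x}"
  using assms by (simp add: cond_prob_def measure_pmf_of_set Int_def card_gt_0_iff)

lemma cond_prob_linearity_test:
  fixes f :: "(nat \<Rightarrow> bit) \<Rightarrow> bit"
  shows "\<P>((x, y, z) in measure_pmf (pmf_of_set (cube (2 * n) \<times> cube (2 * n) \<times> cube (2 * n))).
        f x + f y + f z = f (vec_xor (2 * n) (vec_xor (2 * n) x y) z)
        \<bar> x \<in> middle_slice n \<and> y \<in> middle_slice n \<and> z \<in> middle_slice n \<and>
          vec_xor (2 * n) (vec_xor (2 * n) x y) z \<in> middle_slice n) =
    card {p \<in> slice_triples n. (case p of (x, y, z) \<Rightarrow> f x + f y + f z) = f (xor3 (2 * n) p)}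
      / card (slice_triples n)"
proof -
  have sub: "x \<in> middle_slice n \<Longrightarrow> x \<in> cube (2 * n)" for x
    using middle_slice_subset_cube by blast
  have "cube (2 * n) \<noteq> {}"
    using vec_xor_in_cube by blast
  then show ?thesis
    by (subst cond_prob_pmf_of_set)
      (auto simp: slice_triples_def sub simp del: add_bit_eq_xor
        intro!: arg_cong2[where f = "\<lambda>A B. real (card A) / real (card B)"])
qed

text \<open>Passes minus failures number at least \<open>2 * \<epsilon>\<close> times all triples.
  Both sides are fourth moments with the same factor \<open>k\<close>, so the number of triples need
  not be estimated: it is traded for the fourth moment of the constant 1.\<close>

lemma linearity_test_lower:
  assumes n: "n \<ge> 1"
    and test: "card {p \<in> slice_triples n. (case p of (x, y, z) \<Rightarrow> f x + f y + f z) = f (xor3 (2 * n) p)}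
      / card (slice_triples n) \<ge> 1 / 2 + \<epsilon>" and "\<epsilon> > 0"
  shows "4 * \<epsilon> \<le> (\<Sum>S\<in>Pow {1..2*n}. slice_coeff n (\<lambda>x. bit_sign (f x)) S ^ 4)"
proof -
  let ?T = "slice_triples n" and ?w = "slice_coeff n (\<lambda>_. 1)"
  define k where "k = 2 ^ (2*n) / real (card (middle_slice n)) ^ 4"
  define \<sigma> where "\<sigma> = (\<Sum>p\<in>?T. bit_sign (case p of (x, y, z) \<Rightarrow> f x + f y + f z) * bit_sign (f (xor3 (2 * n) p)))"
  \<comment> \<open>Division by zero gives 0, so an empty set of triples would contradict
    \<open>test\<close>.\<close>
  have T: "card ?T > 0"
    using test \<open>\<epsilon> > 0\<close> by (cases "card ?T = 0") auto
  have "(1 / 2 + \<epsilon>) * card ?T \<le> (card ?T + \<sigma>) / 2"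
    using test T unfolding card_agree_eq[OF finite_slice_triples] \<sigma>_def
    by (simp add: le_divide_eq)
  then have \<sigma>: "2 * \<epsilon> * card ?T \<le> \<sigma>" by (simp add: algebra_simps)
  \<comment> \<open>The sets \<open>{}\<close> and \<open>[2n]\<close>, distinct as
    \<open>n \<ge> 1\<close>, each contribute 1.\<close>
  have "4 * \<epsilon> = 2 * \<epsilon> * (\<Sum>S\<in>{{}, {1..2*n}}. ?w S ^ 4)"
  proof -
    have "\<bar>?w {1..2*n}\<bar> = 1" using slice_coeff_compl[of "{}" n "\<lambda>_. 1"] by simp
    then have "?w {1..2*n} ^ 4 = 1" by (metis power_even_abs_numeral power_one even_numeral)
    then show ?thesis using n by simp
  qed
  also have "\<dots> \<le> 2 * \<epsilon> * (\<Sum>S\<in>Pow {1..2*n}. ?w S ^ 4)"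
    using \<open>\<epsilon> > 0\<close> by (intro mult_left_mono sum_mono2) auto
  also have "\<dots> = k * (2 * \<epsilon> * card ?T)"
    unfolding sum_slice_coeff_power4 k_def by (simp add: case_prod_unfold)
  also have "\<dots> \<le> k * \<sigma>"
    using \<sigma> by (intro mult_left_mono) (auto simp: k_def)
  also have "\<dots> = (\<Sum>S\<in>Pow {1..2*n}. slice_coeff n (\<lambda>x. bit_sign (f x)) S ^ 4)"
    unfolding sum_slice_coeff_power4 k_def \<sigma>_def
    by (simp add: case_prod_unfold bit_sign_add del: add_bit_eq_xor)
  finally show ?thesis .
qed

theorem theorem1p1:
  fixes \<epsilon> :: real
  assumes "\<epsilon> > 0"
  shows "\<exists>n0::nat. \<forall>n\<ge>n0. \<forall>f :: (nat \<Rightarrow> bit) \<Rightarrow> bit.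
    \<P>((x, y, z) in measure_pmf (pmf_of_set (cube (2 * n) \<times> cube (2 * n) \<times> cube (2 * n))).
        f x + f y + f z = f (vec_xor (2 * n) (vec_xor (2 * n) x y) z)
        \<bar> x \<in> middle_slice n \<and> y \<in> middle_slice n \<and> z \<in> middle_slice n \<and>
          vec_xor (2 * n) (vec_xor (2 * n) x y) z \<in> middle_slice n)
      \<ge> 1 / 2 + \<epsilon>
    \<longrightarrow> (\<exists>S \<subseteq> {1..2 * n}. \<exists>b :: bit.
          \<P>(x in measure_pmf (pmf_of_set (middle_slice n)). f x = b + (\<Sum>i\<in>S. x i))
            \<ge> 1 / 2 + sqrt \<epsilon> / 200)"
proof -
  \<comment> \<open>This makes \<open>sqrt n > 2 / \<epsilon>\<close>, which pushes the error
    \<open>4 * sqrt n / (2n - 1)\<close> below \<open>2 * \<epsilon>\<close>.\<close>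
  obtain n0 :: nat where n0: "n0 > (2 / \<epsilon>)\<^sup>2"
    using reals_Archimedean2 by blast
  show ?thesis
  proof (intro exI[of _ n0] allI impI)
    fix n and f :: "(nat \<Rightarrow> bit) \<Rightarrow> bit"
    assume "n \<ge> n0"
      and "\<P>((x, y, z) in measure_pmf (pmf_of_set (cube (2 * n) \<times> cube (2 * n) \<times> cube (2 * n))).
        f x + f y + f z = f (vec_xor (2 * n) (vec_xor (2 * n) x y) z)
        \<bar> x \<in> middle_slice n \<and> y \<in> middle_slice n \<and> z \<in> middle_slice n \<and>
          vec_xor (2 * n) (vec_xor (2 * n) x y) z \<in> middle_slice n) \<ge> 1 / 2 + \<epsilon>"
    note test = this(2)[unfolded cond_prob_linearity_test]
    let ?a = "slice_coeff n (\<lambda>x. bit_sign (f x))"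
    have n: "real n > (2 / \<epsilon>)\<^sup>2" using n0 \<open>n \<ge> n0\<close> by (smt (verit) of_nat_le_iff)
    then have n1: "n \<ge> 1" using zero_le_power2[of "2 / \<epsilon>"] by (cases n) auto
    have "2 / \<epsilon> < sqrt n" using n by (rule real_less_rsqrt)
    then have "2 < \<epsilon> * sqrt n" using assms by (simp add: field_simps)
    then have "2 * sqrt n < \<epsilon> * sqrt n * sqrt n" using n1 by (intro mult_strict_right_mono) auto
    then have "4 * sqrt n < \<epsilon> * (2 * n)" by (simp add: mult.assoc)
    also have "\<dots> \<le> \<epsilon> * (2 * (2 * real n - 1))"
      using n1 assms by (intro mult_left_mono) auto
    finally have err: "4 * sqrt n / (2 * real n - 1) < 2 * \<epsilon>"
      using n1 by (simp add: field_simps)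
    \<comment> \<open>Otherwise the fourth moment is at most \<open>\<epsilon>\<close> plus the
      error, hence below \<open>3 * \<epsilon>\<close>, against the lower bound
      \<open>4 * \<epsilon>\<close>.\<close>
    have "\<exists>S\<subseteq>{1..2*n}. \<epsilon> / 4 < (?a S)\<^sup>2"
    proof (rule ccontr)
      assume "\<not> ?thesis"
      then have "(\<Sum>S\<in>Pow {1..2*n}. ?a S ^ 4) \<le> 4 * (\<epsilon> / 4) + 4 * sqrt n / (2 * real n - 1)"
        by (intro sum_slice_coeff_power4_le[OF n1]) (auto simp: not_less)
      with linearity_test_lower[OF n1 test assms] err assms show False by linarith
    qed
    then obtain S where S: "S \<subseteq> {1..2*n}" "\<epsilon> / 4 < (?a S)\<^sup>2" by blast
    define b :: bit where "b = (if ?a S \<ge> 0 then 0 else 1)"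
    have "sqrt (\<epsilon> / 4) \<le> \<bar>?a S\<bar>"
      using S(2) by (simp add: real_sqrt_le_iff flip: real_sqrt_abs del: real_sqrt_divide)
    then have le: "sqrt \<epsilon> / 2 \<le> \<bar>?a S\<bar>" by (simp add: real_sqrt_divide)
    \<comment> \<open>The advantage obtained is \<open>sqrt \<epsilon> / 4\<close>, weakened here to
      the stated constant.\<close>
    have "1 / 2 + sqrt \<epsilon> / 200 \<le> (1 + sqrt \<epsilon> / 2) / 2"
      using assms by (simp add: add_divide_distrib)
    also have "\<dots> \<le> (1 + \<bar>?a S\<bar>) / 2"
      using le by simp
    also have "\<bar>?a S\<bar> = bit_sign b * ?a S" by (simp add: b_def)
    finally have "1 / 2 + sqrt \<epsilon> / 200 \<le> (1 + bit_sign b * ?a S) / 2" .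
    then show "\<exists>S \<subseteq> {1..2 * n}. \<exists>b :: bit.
          \<P>(x in measure_pmf (pmf_of_set (middle_slice n)). f x = b + (\<Sum>i\<in>S. x i))
            \<ge> 1 / 2 + sqrt \<epsilon> / 200"
      unfolding prob_agree_chi[OF S(1), symmetric] using S(1) by blast
  qed
qed

end
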